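(* Let $q$ be a prime power and $n\geq 1$. Then $$\sum_{i=0}^{n}{n\brack i}_q^2(-1)^iW_i(q)=0,$$ where ${n\brack i}_q=\frac{[n]_q!}{[i]_q![n-i]_q!}$ with $[k]_q!=\prod_{j=1}^k(1+q+\dots+q^{j-1})$, $W_0(q)=1$, and for $i\geq1$, $W_i(q)$ is the number of descending maximal chains of the Segre product poset $B_i(q)\circ_\rho B_i(q)$ with respect to the edge labeling described in the context.
   Context: $B_i(q)$ is the lattice of subspaces of $\mathbb{F}_q^i$ ordered by inclusion, with rank function $\rho(W)=\dim W$. The Segre product $B_i(q)\circ_\rho B_i(q)$ is the subposet of $B_i(q)\times B_i(q)$ (componentwise order) consisting of pairs $(X_1,X_2)$ with $\dim X_1=\dim X_2$. Edge labeling of $B_i(q)$: for a one-dimensional subspace $X$, let $f(X)$ be the index of the rightmost nonzero coordinate of a nonzero vector of $X$; for a subspace $X$ let $A(X)$ be the set of one-dimensional subspaces contained in $X$; for a cover $X\lessdot Y$, the set $f(A(Y))\setminus f(A(X))$ has exactly one element, which is the label $\lambda(X,Y)\in[i]$. The Segre product is labeled by $\lambda((X_1,X_2),(Y_1,Y_2))=(\lambda(X_1,Y_1),\lambda(X_2,Y_2))\in[i]\times[i]$, where $[i]\times[i]$ has the product order $(a,b)\le(c,d)$ iff $a\le c$ and $b\le d$. A maximal chain with label sequence $\lambda_1,\dots,\lambda_i$ is descending if there is no $j$ with $\lambda_j<\lambda_{j+1}$ in this order. *)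

theory Defs
  imports
    Complex_Main
    "HOL-Library.Cardinality"
    "HOL-Library.Function_Algebras"
    "HOL-Library.Product_Order"
    "HOL-Number_Theory.Prime_Powers"
begin

text \<open>
  Vectors over a field are functions \<open>nat \<Rightarrow> 'a\<close>, and the space of \<open>i\<close>-tuples consists of the
  functions vanishing outside the coordinates \<open>1, \<dots>, i\<close>. This lets the dimension \<open>i\<close> vary inside
  a formula, while subspaces and dimensions are those of the library.
\<close>

definition scale_vec :: "'a::field \<Rightarrow> (nat \<Rightarrow> 'a) \<Rightarrow> nat \<Rightarrow> 'a" where
  "scale_vec c v = (\<lambda>j. c * v j)"

global_interpretation fvec: vector_space "scale_vec :: 'a::field \<Rightarrow> (nat \<Rightarrow> 'a) \<Rightarrow> nat \<Rightarrow> 'a"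
  by standard (auto simp: scale_vec_def fun_eq_iff algebra_simps)

definition coord_space :: "nat \<Rightarrow> (nat \<Rightarrow> 'a::field) set" where
  "coord_space i = {v. \<forall>j. j \<notin> {1..i} \<longrightarrow> v j = 0}"

definition subspace_lattice :: "nat \<Rightarrow> (nat \<Rightarrow> 'a::field) set set" where
  "subspace_lattice i = {X. X \<subseteq> coord_space i \<and> fvec.subspace X}"

definition segre_product :: "'p set \<Rightarrow> ('p \<Rightarrow> nat) \<Rightarrow> ('p \<times> 'p) set" where
  "segre_product P \<rho> = {(x, y). x \<in> P \<and> y \<in> P \<and> \<rho> x = \<rho> y}"

definition segre_subspaces :: "nat \<Rightarrow> ((nat \<Rightarrow> 'a::field) set \<times> (nat \<Rightarrow> 'a) set) set" where
  "segre_subspaces i = segre_product (subspace_lattice i) fvec.dim"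

definition rightmost :: "(nat \<Rightarrow> 'a::field) \<Rightarrow> nat" where
  "rightmost v = Max {j. v j \<noteq> 0}"

text \<open>
  The description in the following definition is unique for a one-dimensional \<open>X\<close> inside some
  \<open>coord_space i\<close>, as the nonzero vectors of \<open>X\<close> are nonzero multiples of each other.
\<close>

definition line_index :: "(nat \<Rightarrow> 'a::field) set \<Rightarrow> nat" where
  "line_index X = (THE j. \<exists>v\<in>X. v \<noteq> 0 \<and> j = rightmost v)"

definition lines :: "(nat \<Rightarrow> 'a::field) set \<Rightarrow> (nat \<Rightarrow> 'a) set set" where
  "lines X = {L. fvec.subspace L \<and> fvec.dim L = 1 \<and> L \<subseteq> X}"

definition edge_label :: "(nat \<Rightarrow> 'a::field) set \<Rightarrow> (nat \<Rightarrow> 'a) set \<Rightarrow> nat" where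
  "edge_label X Y = the_elem (line_index ` lines Y - line_index ` lines X)"

definition segre_label ::
  "(nat \<Rightarrow> 'a::field) set \<times> (nat \<Rightarrow> 'a) set \<Rightarrow> (nat \<Rightarrow> 'a) set \<times> (nat \<Rightarrow> 'a) set \<Rightarrow> nat \<times> nat" where
  "segre_label X Y = (edge_label (fst X) (fst Y), edge_label (snd X) (snd Y))"

text \<open>
  A finite maximal chain is represented by the list of its elements in increasing order. The order
  on pairs, both of subspaces and of labels, is the componentwise one of
  \<^theory>\<open>HOL-Library.Product_Order\<close>.
\<close>

definition maximal_chains :: "'p::order set \<Rightarrow> 'p list set" where
  "maximal_chains P = {cs. sorted_wrt (<) cs \<and> pred_on.maxchain P (<) (set cs)}"

definition label_sequence :: "('p \<Rightarrow> 'p \<Rightarrow> 'l) \<Rightarrow> 'p list \<Rightarrow> 'l list" where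
  "label_sequence lab cs = map2 lab (butlast cs) (tl cs)"

definition descending :: "'l::order list \<Rightarrow> bool" where
  "descending ls \<longleftrightarrow> \<not> (\<exists>j. Suc j < length ls \<and> ls ! j < ls ! Suc j)"

definition num_descending_chains :: "'a::{field,finite} itself \<Rightarrow> nat \<Rightarrow> nat" where
  "num_descending_chains _ i =
     (if i = 0 then 1
      else card {cs \<in> maximal_chains
                        (segre_subspaces i :: ((nat \<Rightarrow> 'a) set \<times> (nat \<Rightarrow> 'a) set) set).
                   descending (label_sequence segre_label cs)})"

definition q_fact :: "nat \<Rightarrow> nat \<Rightarrow> real" where
  "q_fact q k = (\<Prod>j=1..k. \<Sum>m<j. real q ^ m)"

definition q_binomial :: "nat \<Rightarrow> nat \<Rightarrow> nat \<Rightarrow> real" where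
  "q_binomial q n i = q_fact q n / (q_fact q i * q_fact q (n - i))"

end

theory Submission
  imports
    Defs
    "HOL-Library.Infinite_Set"
    "HOL-Combinatorics.Multiset_Permutations"
begin

text \<open>
  The labels of a complete flag form a permutation \<open>w\<close>, and over a field with \<open>q\<close> elements exactly
  \<open>q\<close> to the number of inversions of \<open>w\<close> flags have label word \<open>w\<close>. A maximal chain of the Segre
  product is a pair of complete flags, so \<open>W\<^sub>i\<close> is a sum over the pairs of permutations of \<open>{1..i}\<close>
  without common ascent, weighted by inversions.

  Multiplying by the square of the \<open>q\<close>-binomial coefficient turns this into the weighted sum over the
  pairs of permutations of \<open>{1..n}\<close> without common ascent among the first \<open>i\<close> letters and with both
  words increasing on the remaining ones. In the alternating sum over \<open>i\<close> every pair cancels.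
\<close>

section \<open>Inversions and pairs of permutations\<close>

text \<open>The labels carry the product order, so the absence of common ascents couples the two
  words, and W_i is not a product of two counts. The presence of a common ascent decouples: it is an
  ascent in each word. Asking for common ascents throughout the last n - i letters therefore makes
  both tails sorted, and a sorted tail carries no information beyond its letter set. The two letter
  sets are chosen independently, and each choice accounts for one q-binomial coefficient, hence the
  square.

  The weight is that of the cells of the flag variety. With pivots taken at the rightmost nonzero
  coordinate, a subspace X has q^r covers whose new pivot is j, where r is the number of coordinates
  below j that are not pivots of X. These coordinates are the smaller letters that are still to come
  after j, so the product over a flag is q to the number of inversions.\<close>

definition cross_inversions :: "nat set \<Rightarrow> nat set \<Rightarrow> nat" where
  "cross_inversions A B = card {(x, y) \<in> A \<times> B. y < x}"

text \<open>The recursion removes the first letter because flags are built from the bottom: the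
  summand of \<open>x\<close> is the exponent in the number of covers labelled \<open>x\<close>
  while the letters of \<open>xs\<close> are still to come. Since a set is counted, this is the
  inversion number for words without repeated letters.\<close>

fun inversions :: "nat list \<Rightarrow> nat" where
  "inversions [] = 0"
| "inversions (x # xs) = card {y \<in> set xs. y < x} + inversions xs"

lemma cross_inversions_Un_left:
  assumes "finite A" "finite B" "finite C" "A \<inter> B = {}"
  shows "cross_inversions (A \<union> B) C = cross_inversions A C + cross_inversions B C"
proof -
  have "{(x, y) \<in> (A \<union> B) \<times> C. y < x} = {(x, y) \<in> A \<times> C. y < x} \<union> {(x, y) \<in> B \<times> C. y < x}"
    by auto
  moreover have "finite {(x, y) \<in> A \<times> C. y < x}" "finite {(x, y) \<in> B \<times> C. y < x}"
    by (rule finite_subset[of _ "A \<times> C"] finite_subset[of _ "B \<times> C"]; use assms in auto)+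
  ultimately show ?thesis
    unfolding cross_inversions_def using assms(4) by (auto intro!: card_Un_disjoint)
qed

lemma cross_inversions_Un_right:
  assumes "finite A" "finite B" "finite C" "A \<inter> B = {}"
  shows "cross_inversions C (A \<union> B) = cross_inversions C A + cross_inversions C B"
proof -
  have "{(x, y) \<in> C \<times> (A \<union> B). y < x} = {(x, y) \<in> C \<times> A. y < x} \<union> {(x, y) \<in> C \<times> B. y < x}"
    by auto
  moreover have "finite {(x, y) \<in> C \<times> A. y < x}" "finite {(x, y) \<in> C \<times> B. y < x}"
    by (rule finite_subset[of _ "C \<times> A"] finite_subset[of _ "C \<times> B"]; use assms in auto)+
  ultimately show ?thesis
    unfolding cross_inversions_def using assms(4) by (auto intro!: card_Un_disjoint)
qed

lemma cross_inversions_singleton_left: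
  "cross_inversions {x} B = card {y \<in> B. y < x}"
proof -
  have "{(z, y) \<in> {x} \<times> B. y < z} = Pair x ` {y \<in> B. y < x}"
    by auto
  then show ?thesis
    unfolding cross_inversions_def by (simp add: card_image inj_on_def)
qed

text \<open>Inversions between the two halves depend on their letter sets alone. This separates the
  choice of the first letters from their arrangement.\<close>

lemma inversions_append:
  assumes "distinct (us @ vs)"
  shows "inversions (us @ vs) = inversions us + inversions vs + cross_inversions (set us) (set vs)"
  using assms
proof (induction us)
  case Nil
  then show ?case by (simp add: cross_inversions_def)
next
  case (Cons x us)
  have "{y \<in> set (us @ vs). y < x} = {y \<in> set us. y < x} \<union> {y \<in> set vs. y < x}"
    by auto
  moreover have "{y \<in> set us. y < x} \<inter> {y \<in> set vs. y < x} = {}"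
    using Cons.prems by auto
  ultimately have "card {y \<in> set (us @ vs). y < x} = card {y \<in> set us. y < x} + card {y \<in> set vs. y < x}"
    by (simp add: card_Un_disjoint)
  moreover have "cross_inversions (set (x # us)) (set vs) =
      card {y \<in> set vs. y < x} + cross_inversions (set us) (set vs)"
    using cross_inversions_Un_left[of "{x}" "set us" "set vs"] Cons.prems
    by (simp add: cross_inversions_singleton_left)
  ultimately show ?case
    using Cons by simp
qed

lemma inversions_sorted:
  assumes "sorted xs"
  shows "inversions xs = 0"
  using assms
proof (induction xs)
  case (Cons x xs)
  then have "{y \<in> set xs. y < x} = {}" by fastforce
  then show ?case using Cons by simp
qed simp

text \<open>Only the relative order of letters matters, so words on any \<open>i\<close> letters can
  be standardized to words on \<open>{1..i}\<close>.\<close>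

lemma inversions_map_strict_mono:
  assumes "strict_mono_on (set xs) f"
  shows "inversions (map f xs) = inversions xs"
  using assms
proof (induction xs)
  case (Cons x xs)
  have "{y \<in> set (map f xs). y < f x} = f ` {y \<in> set xs. y < x}"
    using strict_mono_on_less[OF Cons.prems] by auto
  moreover have "inj_on f {y \<in> set xs. y < x}"
    using strict_mono_on_imp_inj_on[OF Cons.prems] by (rule inj_on_subset) auto
  moreover have "strict_mono_on (set xs) f"
    using Cons.prems by (auto simp: strict_mono_on_def)
  ultimately show ?case
    using Cons.IH by (simp add: card_image)
qed simp

section \<open>q-factorials and q-binomial coefficients\<close>

lemma q_fact_Suc: "q_fact q (Suc k) = q_fact q k * (\<Sum>m<Suc k. real q ^ m)"
  by (simp add: q_fact_def)

lemma q_fact_pos: "q_fact q k > 0"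
proof -
  have "(\<Sum>m<j. real q ^ m) > 0" if "j \<in> {1..k}" for j
  proof -
    have "(1::real) = (\<Sum>m<1. real q ^ m)" by simp
    also have "\<dots> \<le> (\<Sum>m<j. real q ^ m)"
      by (rule sum_mono2) (use that in auto)
    finally show ?thesis by simp
  qed
  then show ?thesis
    unfolding q_fact_def by (intro prod_pos) auto
qed

text \<open>The q-Pascal rule. With [k] = 1 + q + ... + q^(k-1) and n = i + m + 1 it comes from
  [n+1] = [m+1] + q^(m+1) [i+1]. For \<open>i = n\<close> it fails: the truncated difference
  \<open>n - Suc i\<close> is 0 and leaves \<open>q_binomial q n (Suc i)\<close> nonzero.\<close>

lemma q_binomial_Suc:
  assumes "i < n"
  shows "q_binomial q (Suc n) (Suc i) =
    q_binomial q n (Suc i) + real q ^ (n - i) * q_binomial q n i"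
proof -
  define m where "m = n - Suc i"
  have n: "n = Suc (i + m)" using assms by (simp add: m_def)
  have ge: "(\<Sum>k<Suc l. real q ^ k) > 0" for l
    using q_fact_pos[of q "Suc l"] q_fact_pos[of q l] unfolding q_fact_Suc
    by (simp add: zero_less_mult_iff)
  have split: "(\<Sum>k<Suc n. real q ^ k) = (\<Sum>k<Suc m. real q ^ k) + real q ^ Suc m * (\<Sum>k<Suc i. real q ^ k)"
  proof -
    have "(\<Sum>k<a + b. real q ^ k) = (\<Sum>k<a. real q ^ k) + real q ^ a * (\<Sum>k<b. real q ^ k)" for a b
      by (induction b) (simp_all add: algebra_simps power_add)
    from this[of "Suc m" "Suc i"] show ?thesis by (simp add: n add.commute)
  qed
  define a b where "a = (\<Sum>k<Suc m. real q ^ k)" and "b = (\<Sum>k<Suc i. real q ^ k)"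
  have "a > 0" "b > 0" using ge by (simp_all only: a_def b_def)
  have "Suc n - Suc i = Suc m" "n - Suc i = m" "n - i = Suc m" by (simp_all add: n)
  then show ?thesis
    using q_fact_pos[of q i] q_fact_pos[of q m] \<open>a > 0\<close> \<open>b > 0\<close>
    unfolding q_binomial_def
    by (simp only: q_fact_Suc split flip: a_def b_def) (simp add: field_simps)
qed

lemma q_binomial_0: "q_binomial q n 0 = 1"
  using q_fact_pos[of q n] by (simp add: q_binomial_def q_fact_def[of q 0])

lemma q_binomial_self: "q_binomial q n n = 1"
  using q_fact_pos[of q n] by (simp add: q_binomial_def q_fact_def[of q 0])

text \<open>Split by whether the largest element \<open>Suc n\<close> lies in \<open>P\<close>.
  Outside \<open>P\<close> it causes no inversion; inside, it exceeds all \<open>n - j\<close>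
  elements of the complement. These are the two terms of the q-Pascal rule.\<close>

lemma sum_cross_inversions:
  assumes "i \<le> n"
  shows "(\<Sum>P | P \<subseteq> {1..n} \<and> card P = i. real q ^ cross_inversions P ({1..n} - P)) = q_binomial q n i"
  using assms
proof (induction n arbitrary: i)
  case 0
  then have "{P. P \<subseteq> {1..0::nat} \<and> card P = i} = {{}}" by auto
  then show ?case using 0 by (simp add: q_binomial_0 cross_inversions_def)
next
  case (Suc n)
  show ?case
  proof (cases i)
    case 0
    then have "{P. P \<subseteq> {1..Suc n} \<and> card P = i} = {{}}" by (auto simp: finite_subset)
    then show ?thesis by (simp add: 0 q_binomial_0 cross_inversions_def)
  next
    case i: (Suc j)
    show ?thesis
    proof (cases "j = n")
      \<comment> \<open>The boundary case excluded from \<open>q_binomial_Suc\<close>: the full set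
        is the only summand.\<close>
      case True
      have "{P. P \<subseteq> {1..Suc n} \<and> card P = i} = {{1..Suc n}}"
        using card_subset_eq[of "{1..Suc n}"] by (auto simp: i True)
      then show ?thesis by (simp add: i True q_binomial_self cross_inversions_def)
    next
      case False
      then have "j < n" using Suc.prems i by simp
      let ?N = "Suc n"
      let ?A = "{P. P \<subseteq> {1..n} \<and> card P = i}" and ?B = "{P. P \<subseteq> {1..n} \<and> card P = j}"
      have decomp: "{P. P \<subseteq> {1..?N} \<and> card P = i} = ?A \<union> insert ?N ` ?B" (is "?L = ?R")
      proof (intro equalityI subsetI)
        fix P assume P: "P \<in> ?L"
        show "P \<in> ?R"
        proof (cases "?N \<in> P")
          case True
          then have "P = insert ?N (P - {?N})" by auto
          moreover have "P - {?N} \<in> ?B"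
            using P True by (auto simp: i le_Suc_eq)
          ultimately show ?thesis by blast
        next
          case False
          then have "P \<subseteq> {1..n}" using P by (fastforce simp: le_Suc_eq)
          then show ?thesis using P by auto
        qed
      next
        fix P assume "P \<in> ?R"
        then consider "P \<in> ?A" | Q where "Q \<in> ?B" "P = insert ?N Q" by blast
        then show "P \<in> ?L"
        proof cases
          case 1
          then show ?thesis by fastforce
        next
          case 2
          then have "?N \<notin> Q" "finite Q" by (auto intro: finite_subset)
          then show ?thesis using 2 by (fastforce simp: i)
        qed
      qed
      have fin: "finite ?A" "finite ?B"
        by (rule finite_subset[of _ "Pow {1..n}"]; auto)+
      have disj: "?A \<inter> insert ?N ` ?B = {}" by fastforce
      have inj: "inj_on (insert ?N) ?B"
      proof (rule inj_onI)
        fix P Q assume "P \<in> ?B" "Q \<in> ?B" and eq: "insert ?N P = insert ?N Q"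
        then have "?N \<notin> P" "?N \<notin> Q" by auto
        then show "P = Q" using eq by (simp add: insert_ident)
      qed
      have 1: "cross_inversions P ({1..?N} - P) = cross_inversions P ({1..n} - P)" if "P \<in> ?A" for P
      proof -
        have "{1..?N} - P = ({1..n} - P) \<union> {?N}" using that by (auto simp: le_Suc_eq)
        moreover have "cross_inversions P {?N} = 0"
          using that by (auto simp: cross_inversions_def card_eq_0_iff)
        ultimately show ?thesis
          using that cross_inversions_Un_right[of "{1..n} - P" "{?N}" P] by (auto intro: finite_subset)
      qed
      have 2: "cross_inversions (insert ?N P) ({1..?N} - insert ?N P) =
          (n - j) + cross_inversions P ({1..n} - P)" if "P \<in> ?B" for P
      proof -
        have finP: "finite P" "P \<subseteq> {1..n}" "card P = j" using that by (auto intro: finite_subset)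
        have "{1..?N} - insert ?N P = {1..n} - P" by (auto simp: le_Suc_eq)
        moreover have "cross_inversions ({?N} \<union> P) ({1..n} - P) =
            cross_inversions {?N} ({1..n} - P) + cross_inversions P ({1..n} - P)"
          using finP by (intro cross_inversions_Un_left) auto
        moreover have "cross_inversions {?N} ({1..n} - P) = n - j"
        proof -
          have "{y \<in> {1..n} - P. y < ?N} = {1..n} - P" by auto
          then show ?thesis using finP
            by (simp add: cross_inversions_singleton_left card_Diff_subset)
        qed
        ultimately show ?thesis by simp
      qed
      have "(\<Sum>P | P \<subseteq> {1..?N} \<and> card P = i. real q ^ cross_inversions P ({1..?N} - P)) =
          (\<Sum>P\<in>?A. real q ^ cross_inversions P ({1..?N} - P)) +
          (\<Sum>P\<in>insert ?N ` ?B. real q ^ cross_inversions P ({1..?N} - P))"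
        unfolding decomp using fin disj by (intro sum.union_disjoint) auto
      also have "(\<Sum>P\<in>insert ?N ` ?B. real q ^ cross_inversions P ({1..?N} - P)) =
          (\<Sum>P\<in>?B. real q ^ ((n - j) + cross_inversions P ({1..n} - P)))"
        unfolding sum.reindex[OF inj] o_def by (intro sum.cong refl) (simp only: 2)
      also have "\<dots> = real q ^ (n - j) * (\<Sum>P\<in>?B. real q ^ cross_inversions P ({1..n} - P))"
        by (simp add: power_add sum_distrib_left)
      also have "(\<Sum>P\<in>?A. real q ^ cross_inversions P ({1..?N} - P)) =
          (\<Sum>P\<in>?A. real q ^ cross_inversions P ({1..n} - P))"
        using 1 by simp
      finally show ?thesis
        using Suc.IH[of i] Suc.IH[of j] \<open>j < n\<close> by (simp add: i q_binomial_Suc)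
    qed
  qed
qed

text \<open>A word with sorted tail amounts to the set \<open>P\<close> of its first
  \<open>i\<close> letters and their arrangement. Its inversions are those of the arrangement plus
  the cross inversions of \<open>P\<close> with its complement, so the sum factors once the
  arrangement is standardized. The function \<open>h\<close> stands for the descent condition with
  the other word held fixed; its hypothesis is invariance under standardization.\<close>

lemma sum_permutations_sorted_tail:
  fixes h :: "nat list \<Rightarrow> real"
  assumes "i \<le> n"
    and h: "\<And>f u. strict_mono_on (set u) f \<Longrightarrow> h (map f u) = h u"
  shows "(\<Sum>s | s \<in> permutations_of_set {1..n} \<and> sorted (drop i s).
            h (take i s) * real q ^ inversions s) =
         q_binomial q n i * (\<Sum>u\<in>permutations_of_set {1..i}. h u * real q ^ inversions u)"
proof -
  let ?S = "{P. P \<subseteq> {1..n} \<and> card P = i}"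
  let ?tail = "\<lambda>P. sorted_list_of_set ({1..n} - P)"
  have finS: "finite ?S" by (rule finite_subset[of _ "Pow {1..n}"]) auto
  have "(\<Sum>s | s \<in> permutations_of_set {1..n} \<and> sorted (drop i s). h (take i s) * real q ^ inversions s) =
    (\<Sum>(P, u)\<in>Sigma ?S permutations_of_set.
        real q ^ cross_inversions P ({1..n} - P) * (h u * real q ^ inversions u))"
  proof (rule sum.reindex_bij_witness[of _ "\<lambda>(P, u). u @ ?tail P" "\<lambda>s. (set (take i s), take i s)"],
      goal_cases)
    case (1 s)
    then have s: "set s = {1..n}" "distinct s" "sorted (drop i s)"
      by (auto dest: permutations_of_setD)
    then have "{1..n} - set (take i s) = set (drop i s)"
      using set_take_disj_set_drop_if_distinct[of s i i] append_take_drop_id[of i s] set_append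
      by (metis Un_Diff Diff_cancel Diff_triv inf_commute order_refl sup_bot_left)
    then show ?case using s
      by (simp add: sorted_list_of_set.idem_if_sorted_distinct)
  next
    case (2 s)
    then have s: "set s = {1..n}" "distinct s" "sorted (drop i s)"
      by (auto dest: permutations_of_setD)
    then have "length s = n" using distinct_card[of s] by simp
    then show ?case
      using s assms set_take_subset[of i s] distinct_card[of "take i s"]
      by (auto intro!: permutations_of_setI)
  next
    case (3 b)
    then obtain P u where b: "b = (P, u)" "P \<subseteq> {1..n}" "card P = i" "set u = P" "distinct u"
      by (auto dest: permutations_of_setD)
    then show ?case using distinct_card[of u] by simp
  next
    case (4 b)
    then obtain P u where b: "b = (P, u)" "P \<subseteq> {1..n}" "card P = i" "set u = P" "distinct u"
      by (auto dest: permutations_of_setD)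
    then show ?case using distinct_card[of u] by (auto intro!: permutations_of_setI)
  next
    case (5 s)
    then have s: "set s = {1..n}" "distinct s" "sorted (drop i s)"
      by (auto dest: permutations_of_setD)
    have "{1..n} - set (take i s) = set (drop i s)"
      using s set_take_disj_set_drop_if_distinct[of s i i] append_take_drop_id[of i s] set_append
      by (metis Un_Diff Diff_cancel Diff_triv inf_commute order_refl sup_bot_left)
    moreover have "inversions s = inversions (take i s) + cross_inversions (set (take i s)) (set (drop i s))"
      using inversions_append[of "take i s" "drop i s"] s(2) inversions_sorted[OF s(3)] by simp
    ultimately show ?case by (simp add: power_add)
  qed
  also have "\<dots> = (\<Sum>P\<in>?S. \<Sum>u\<in>permutations_of_set P.
      real q ^ cross_inversions P ({1..n} - P) * (h u * real q ^ inversions u))"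
    using finS by (subst sum.Sigma) auto
  also have "\<dots> = (\<Sum>P\<in>?S. real q ^ cross_inversions P ({1..n} - P) *
      (\<Sum>u\<in>permutations_of_set {1..i}. h u * real q ^ inversions u))"
  proof (rule sum.cong[OF refl])
    fix P assume P: "P \<in> ?S"
    then have "finite P" "card P = i" by (auto intro: finite_subset)
    then obtain g where g: "bij_betw g {..<i} P" "strict_mono_on {..<i} g"
      using ex_bij_betw_strict_mono_card[of P] by metis
    \<comment> \<open>The enumeration \<open>g\<close> of \<open>P\<close> starts at 0, whereas the
      letters of standardized words start at 1.\<close>
    define f where "f = (\<lambda>k. g (k - 1))"
    have "bij_betw (\<lambda>k. k - 1) {1..i} {..<i}"
      by (rule bij_betw_byWitness[of _ Suc]) auto
    from bij_betw_trans[OF this g(1)] have f: "bij_betw f {1..i} P"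
      by (simp add: f_def comp_def)
    have f_mono: "strict_mono_on {1..i} f"
      unfolding f_def by (rule strict_mono_onI, rule strict_mono_onD[OF g(2)]) auto
    have inj: "inj_on f {1..i}" and "P = f ` {1..i}" using f by (auto simp: bij_betw_def)
    then have "permutations_of_set P = map f ` permutations_of_set {1..i}"
      by (simp add: permutations_of_set_image_inj)
    moreover have "inj_on (map f) (permutations_of_set {1..i})"
      by (rule inj_onI, rule map_inj_on[of f]) (use inj in \<open>simp_all add: permutations_of_setD\<close>)
    ultimately have "(\<Sum>u\<in>permutations_of_set P. h u * real q ^ inversions u) =
        (\<Sum>u\<in>permutations_of_set {1..i}. h (map f u) * real q ^ inversions (map f u))"
      by (simp add: sum.reindex)
    also have "\<dots> = (\<Sum>u\<in>permutations_of_set {1..i}. h u * real q ^ inversions u)"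
      by (intro sum.cong refl) (use f_mono in \<open>simp add: h inversions_map_strict_mono permutations_of_setD\<close>)
    finally show "(\<Sum>u\<in>permutations_of_set P.
        real q ^ cross_inversions P ({1..n} - P) * (h u * real q ^ inversions u)) =
      real q ^ cross_inversions P ({1..n} - P) *
        (\<Sum>u\<in>permutations_of_set {1..i}. h u * real q ^ inversions u)"
      by (simp flip: sum_distrib_left)
  qed
  also have "\<dots> = q_binomial q n i * (\<Sum>u\<in>permutations_of_set {1..i}. h u * real q ^ inversions u)"
    using sum_cross_inversions[OF assms(1), of q] by (simp add: sum_distrib_right[symmetric])
  finally show ?thesis .
qed

section \<open>Common ascents in words of pairs\<close>

lemma descending_iff_successively:
  "descending ls \<longleftrightarrow> successively (\<lambda>x y. \<not> x < y) ls"
  by (auto simp: descending_def successively_conv_nth)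

text \<open>
  A word with ascents exactly at the last positions is counted by two consecutive values of \<open>i\<close>:
  the letter at the boundary may be put on either side.
\<close>

lemma alternating_sum_descending_ascending:
  fixes ls :: "'l::order list"
  assumes "ls \<noteq> []"
  shows "(\<Sum>i=0..length ls. (-1) ^ i * of_bool (descending (take i ls) \<and> successively (<) (drop i ls))) = (0::real)"
  using assms
proof (induction ls)
  case (Cons x l)
  \<comment> \<open>The term \<open>i = 0\<close> is taken out and the other indices are shifted
    down by one, which reverses their signs.\<close>
  have split: "(\<Sum>i=0..length (x # l). (-1) ^ i *
        of_bool (descending (take i (x # l)) \<and> successively (<) (drop i (x # l)))) =
      of_bool (successively (<) (x # l)) -
      (\<Sum>i=0..length l. (-1) ^ i * of_bool (descending (x # take i l) \<and> successively (<) (drop i l)) :: real)"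
    unfolding list.size sum.atLeast0_atMost_Suc_shift add_0_right add_Suc_right
    by (simp add: descending_iff_successively o_def sum_negf
      del: sum.atLeast0_atMost_Suc sum_mult_of_bool_eq sum_of_bool_mult_eq)
  show ?case
  proof (cases l)
    case Nil
    then show ?thesis unfolding split by (simp add: descending_iff_successively)
  next
    case (Cons y l')
    show ?thesis
    proof (cases "x < y")
      \<comment> \<open>A nonempty prefix of \<open>l\<close> with \<open>x\<close> in front
        contains the ascent from \<open>x\<close> to \<open>y\<close>. Only index 0 survives, and it
        cancels the separate term, since here \<open>x # l\<close> is increasing exactly if
        \<open>l\<close> is.\<close>
      case True
      have "(\<Sum>i=0..length l. (-1) ^ i * of_bool (descending (x # take i l) \<and> successively (<) (drop i l)) :: real) =
          (\<Sum>i=0..length l. if i = 0 then of_bool (successively (<) l) else 0)"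
        using True by (intro sum.cong refl)
          (auto simp: Cons descending_iff_successively take_Cons split: nat.splits)
      then show ?thesis unfolding split using True by (simp add: Cons)
    next
      \<comment> \<open>The separate term vanishes, and \<open>x\<close> in front of a prefix of
        \<open>l\<close> creates no ascent, so what remains is the sum of the induction
        hypothesis.\<close>
      case False
      have "(\<Sum>i=0..length l. (-1) ^ i * of_bool (descending (x # take i l) \<and> successively (<) (drop i l)) :: real) =
          (\<Sum>i=0..length l. (-1) ^ i * of_bool (descending (take i l) \<and> successively (<) (drop i l)))"
        using False by (intro sum.cong refl)
          (auto simp: Cons descending_iff_successively take_Cons split: nat.splits)
      then show ?thesis unfolding split using False Cons.IH by (simp add: Cons)
    qed
  qed
qed simp

text \<open>A pair may grow strictly while one component stays equal. Distinct letters exclude this,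
  so a common ascent is an ascent in both words.\<close>

lemma successively_less_zip_iff:
  fixes s t :: "nat list"
  assumes "distinct s" "distinct t" "length s = length t"
  shows "successively (<) (zip s t) \<longleftrightarrow> sorted s \<and> sorted t"
proof -
  have "(s ! j, t ! j) < (s ! Suc j, t ! Suc j) \<longleftrightarrow> s ! j \<le> s ! Suc j \<and> t ! j \<le> t ! Suc j"
    if "Suc j < length s" for j
    using that assms nth_eq_iff_index_eq[of s j "Suc j"] by (auto simp: less_le)
  then show ?thesis
    using assms(3) by (auto simp: successively_conv_nth sorted_iff_nth_Suc)
qed

text \<open>Provides the hypothesis on \<open>h\<close> in
  \<open>sum_permutations_sorted_tail\<close> when the first word varies and the second is
  fixed.\<close>

lemma descending_zip_map_left:
  fixes u v :: "nat list"
  assumes "strict_mono_on (set u) f"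
  shows "descending (zip (map f u) v) \<longleftrightarrow> descending (zip u v)"
proof -
  have "(f (u ! j), v ! j) < (f (u ! Suc j), v ! Suc j) \<longleftrightarrow> (u ! j, v ! j) < (u ! Suc j, v ! Suc j)"
    if "Suc j < length u" for j
    using that strict_mono_on_less_eq[OF assms, of "u ! j" "u ! Suc j"]
      strict_mono_on_less_eq[OF assms, of "u ! Suc j" "u ! j"]
    by (simp add: less_le_not_le)
  then show ?thesis
    by (auto simp: descending_def)
qed

lemma descending_zip_map_right:
  fixes u v :: "nat list"
  assumes "strict_mono_on (set v) f"
  shows "descending (zip u (map f v)) \<longleftrightarrow> descending (zip u v)"
proof -
  have "(u ! j, f (v ! j)) < (u ! Suc j, f (v ! Suc j)) \<longleftrightarrow> (u ! j, v ! j) < (u ! Suc j, v ! Suc j)"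
    if "Suc j < length v" for j
    using that strict_mono_on_less_eq[OF assms, of "v ! j" "v ! Suc j"]
      strict_mono_on_less_eq[OF assms, of "v ! Suc j" "v ! j"]
    by (simp add: less_le_not_le)
  then show ?thesis
    by (auto simp: descending_def)
qed

text \<open>The combinatorial form of W_i: each pair of label words is weighted by the number of
  pairs of complete flags that carry it.\<close>

definition descending_weight :: "nat \<Rightarrow> nat \<Rightarrow> real" where
  "descending_weight q i = (\<Sum>s\<in>permutations_of_set {1..i}. \<Sum>t\<in>permutations_of_set {1..i}.
     of_bool (descending (zip s t)) * real q ^ (inversions s + inversions t))"

text \<open>The descent condition involves both words, so the two coefficients are absorbed one
  after the other: first with the second word fixed, then with the first \<open>i\<close> letters of
  the extended first word fixed.\<close>

lemma q_binomial_square_descending_weight: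
  assumes "i \<le> n"
  shows "(q_binomial q n i)\<^sup>2 * descending_weight q i =
    (\<Sum>s\<in>permutations_of_set {1..n}. \<Sum>t\<in>permutations_of_set {1..n}.
      of_bool (descending (take i (zip s t)) \<and> successively (<) (drop i (zip s t))) *
        real q ^ (inversions s + inversions t))"
proof -
  let ?S = "\<lambda>i. permutations_of_set {1..i}"
  let ?T = "{s. s \<in> ?S n \<and> sorted (drop i s)}"
  let ?w = "\<lambda>s. real q ^ inversions s"
  let ?d = "\<lambda>s t. of_bool (descending (zip s t)) :: real"
  have "(q_binomial q n i)\<^sup>2 * descending_weight q i =
      q_binomial q n i * (\<Sum>t\<in>?S i. (q_binomial q n i * (\<Sum>s\<in>?S i. ?d s t * ?w s)) * ?w t)"
    unfolding descending_weight_def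
    by (subst sum.swap) (simp add: sum_distrib_left sum_distrib_right power_add power2_eq_square mult_ac
      del: sum_mult_of_bool_eq sum_of_bool_mult_eq)
  also have "\<dots> = q_binomial q n i * (\<Sum>t\<in>?S i. (\<Sum>s\<in>?T. ?d (take i s) t * ?w s) * ?w t)"
    by (subst sum_permutations_sorted_tail[OF assms, of "\<lambda>s. ?d s _"])
      (simp_all add: descending_zip_map_left)
  also have "\<dots> = (\<Sum>s\<in>?T. ?w s * (q_binomial q n i * (\<Sum>t\<in>?S i. ?d (take i s) t * ?w t)))"
    unfolding sum_distrib_left sum_distrib_right
    by (subst sum.swap) (simp add: mult_ac del: sum_mult_of_bool_eq sum_of_bool_mult_eq)
  also have "\<dots> = (\<Sum>s\<in>?T. ?w s * (\<Sum>t\<in>?T. ?d (take i s) (take i t) * ?w t))"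
    by (subst sum_permutations_sorted_tail[OF assms, of "\<lambda>t. ?d _ t"])
      (simp_all add: descending_zip_map_right)
  also have "\<dots> = (\<Sum>s\<in>?S n. \<Sum>t\<in>?S n. of_bool (sorted (drop i s)) * of_bool (sorted (drop i t)) *
      (?d (take i s) (take i t) * (?w s * ?w t)))"
    unfolding Collect_conj_eq Collect_mem_eq
    by (subst (1 2) sum.inter_restrict)
      (auto intro!: sum.cong simp: sum_distrib_left mult_ac simp del: sum_mult_of_bool_eq sum_of_bool_mult_eq)
  also have "\<dots> = (\<Sum>s\<in>?S n. \<Sum>t\<in>?S n.
      of_bool (descending (take i (zip s t)) \<and> successively (<) (drop i (zip s t))) *
        real q ^ (inversions s + inversions t))"
  proof (intro sum.cong refl)
    fix s t assume "s \<in> ?S n" "t \<in> ?S n"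
    then have "distinct s" "distinct t" "length s = length t"
      by (auto dest: permutations_of_setD simp: length_finite_permutations_of_set)
    then have "successively (<) (drop i (zip s t)) \<longleftrightarrow> sorted (drop i s) \<and> sorted (drop i t)"
      by (simp add: drop_zip successively_less_zip_iff)
    then show "of_bool (sorted (drop i s)) * of_bool (sorted (drop i t)) * (?d (take i s) (take i t) * (?w s * ?w t)) =
      of_bool (descending (take i (zip s t)) \<and> successively (<) (drop i (zip s t))) *
        real q ^ (inversions s + inversions t)"
      by (auto simp: take_zip power_add)
  qed
  finally show ?thesis .
qed

lemma alternating_sum_descending_weight:
  assumes "n \<ge> 1"
  shows "(\<Sum>i=0..n. (q_binomial q n i)\<^sup>2 * (-1) ^ i * descending_weight q i) = 0"
proof -
  let ?S = "permutations_of_set {1..n}"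
  let ?b = "\<lambda>i s t. of_bool (descending (take i (zip s t)) \<and> successively (<) (drop i (zip s t))) :: real"
  let ?w = "\<lambda>s t. real q ^ (inversions s + inversions t)"
  have "(\<Sum>i=0..n. (q_binomial q n i)\<^sup>2 * (-1) ^ i * descending_weight q i) =
      (\<Sum>i=0..n. (-1) ^ i * ((q_binomial q n i)\<^sup>2 * descending_weight q i))"
    by (simp add: mult_ac)
  also have "\<dots> = (\<Sum>i=0..n. (-1) ^ i * (\<Sum>s\<in>?S. \<Sum>t\<in>?S. ?b i s t * ?w s t))"
    by (simp add: q_binomial_square_descending_weight)
  also have "\<dots> = (\<Sum>i=0..n. \<Sum>s\<in>?S. \<Sum>t\<in>?S. (-1) ^ i * ?b i s t * ?w s t)"
    by (simp add: sum_distrib_left mult.assoc del: sum_mult_of_bool_eq sum_of_bool_mult_eq)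
  also have "\<dots> = (\<Sum>s\<in>?S. \<Sum>i=0..n. \<Sum>t\<in>?S. (-1) ^ i * ?b i s t * ?w s t)"
    by (rule sum.swap)
  also have "\<dots> = (\<Sum>s\<in>?S. \<Sum>t\<in>?S. \<Sum>i=0..n. (-1) ^ i * ?b i s t * ?w s t)"
    by (intro sum.cong refl sum.swap)
  also have "\<dots> = (\<Sum>s\<in>?S. \<Sum>t\<in>?S. (\<Sum>i=0..n. (-1) ^ i * ?b i s t) * ?w s t)"
    by (simp only: sum_distrib_right)
  also have "\<dots> = 0"
  proof (intro sum.neutral ballI)
    fix s t assume "s \<in> ?S" "t \<in> ?S"
    then have "length s = n" "length t = n"
      by (auto simp: length_finite_permutations_of_set)
    \<comment> \<open>Here \<open>n \<ge> 1\<close> enters: for the empty word the alternating sum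
      is 1.\<close>
    then have "length (zip s t) = n" "zip s t \<noteq> []" using assms by auto
    then have "(\<Sum>i=0..n. (-1) ^ i * ?b i s t) = 0"
      using alternating_sum_descending_ascending[of "zip s t"] by simp
    then show "(\<Sum>i=0..n. (-1) ^ i * ?b i s t) * ?w s t = 0" by simp
  qed
  finally show ?thesis .
qed

section \<open>Pivots of subspaces\<close>

lemma rightmost_eqI:
  assumes "v j \<noteq> 0" "\<And>k. k > j \<Longrightarrow> v k = 0"
  shows "rightmost v = j"
  unfolding rightmost_def
proof (rule Max_eqI)
  have le: "k \<le> j" if "v k \<noteq> 0" for k
    using assms(2)[of k] that by (cases "k > j") auto
  then show "finite {j. v j \<noteq> 0}"
    by (auto intro: finite_subset[of _ "{..j}"])
  show "k \<le> j" if "k \<in> {j. v j \<noteq> 0}" for k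
    using le that by simp
qed (use assms(1) in simp)

lemma rightmost_nonzero:
  assumes "v \<in> coord_space i" "v \<noteq> 0"
  shows "v (rightmost v) \<noteq> 0" "rightmost v \<in> {1..i}" "k > rightmost v \<Longrightarrow> v k = 0"
proof -
  let ?S = "{j. v j \<noteq> 0}"
  have S: "?S \<subseteq> {1..i}" using assms(1) by (auto simp: coord_space_def)
  then have fin: "finite ?S" by (rule finite_subset) simp
  have "?S \<noteq> {}" using assms(2) by (auto simp: fun_eq_iff)
  then have "rightmost v \<in> ?S" unfolding rightmost_def using fin by (rule Max_in[rotated])
  then show "v (rightmost v) \<noteq> 0" "rightmost v \<in> {1..i}" using S by auto
  show "v k = 0" if "k > rightmost v"
    using that Max_ge[OF fin, of k] unfolding rightmost_def by fastforce
qed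

lemma subspace_coord_space: "fvec.subspace (coord_space i)"
  by (auto simp: fvec.subspace_def coord_space_def scale_vec_def)

lemma coord_space_mono: "i \<le> j \<Longrightarrow> coord_space i \<subseteq> coord_space j"
  by (auto simp: coord_space_def)

lemma coord_space_0: "coord_space 0 = {0}"
  by (auto simp: coord_space_def fun_eq_iff)

lemma coord_space_SucD: "v \<in> coord_space (Suc i) \<Longrightarrow> v (Suc i) = 0 \<Longrightarrow> v \<in> coord_space i"
  by (auto simp: coord_space_def le_Suc_eq)

lemma rightmost_le_iff:
  assumes "v \<in> coord_space i" "v \<noteq> 0"
  shows "rightmost v \<le> j \<longleftrightarrow> v \<in> coord_space j"
proof
  assume "rightmost v \<le> j"
  then show "v \<in> coord_space j"
    using rightmost_nonzero(3)[OF assms] assms(1) unfolding coord_space_def by fastforce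
next
  assume "v \<in> coord_space j"
  then show "rightmost v \<le> j" using rightmost_nonzero(2) assms(2) by fastforce
qed

text \<open>For a subspace this is the set f(A(X)) of the labelling, expressed by vectors instead of
  lines; \<open>line_index_lines\<close> proves the agreement. It is also the set of pivot columns
  of an echelon form of X that is reduced from the right.\<close>

definition pivots :: "(nat \<Rightarrow> 'a::field) set \<Rightarrow> nat set" where
  "pivots X = rightmost ` (X - {0})"

lemma pivots_mono: "X \<subseteq> Y \<Longrightarrow> pivots X \<subseteq> pivots Y"
  by (auto simp: pivots_def)

lemma pivots_subset: "X \<subseteq> coord_space i \<Longrightarrow> pivots X \<subseteq> {1..i}"
  using rightmost_nonzero(2) by (fastforce simp: pivots_def)

lemma finite_pivots: "X \<subseteq> coord_space i \<Longrightarrow> finite (pivots X)"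
  by (rule finite_subset[OF pivots_subset]) auto

lemma pivots_zero: "pivots {0} = {}"
  by (simp add: pivots_def)

lemma pivots_coord_space: "pivots (coord_space i :: (nat \<Rightarrow> 'a::field) set) = {1..i}"
proof
  show "{1..i} \<subseteq> pivots (coord_space i :: (nat \<Rightarrow> 'a) set)"
  proof
    fix j assume j: "j \<in> {1..i}"
    let ?e = "(\<lambda>k. if k = j then 1 else 0) :: nat \<Rightarrow> 'a"
    have "rightmost ?e = j" by (rule rightmost_eqI) auto
    moreover have "?e \<in> coord_space i" using j by (auto simp: coord_space_def)
    moreover have "?e \<noteq> 0" by (auto simp: fun_eq_iff)
    ultimately show "j \<in> pivots (coord_space i :: (nat \<Rightarrow> 'a) set)"
      unfolding pivots_def by (intro image_eqI[of _ _ ?e]) simp_all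
  qed
qed (rule pivots_subset, simp)

text \<open>Intersecting with the standard coordinate flag truncates the pivot set, so pivot counts
  give the sizes of these intersections.\<close>

lemma pivots_Int_coord_space:
  assumes "X \<subseteq> coord_space i"
  shows "pivots (X \<inter> coord_space j) = pivots X \<inter> {..j}"
proof -
  have "X \<inter> coord_space j - {0} = {v \<in> X - {0}. rightmost v \<le> j}"
    using assms rightmost_le_iff[of _ i j] by blast
  then show ?thesis unfolding pivots_def by auto
qed

text \<open>Gaussian elimination from the last coordinate. If some vector of X is nonzero there, X
  is the direct sum of a line and its part \<open>Y\<close> in the smaller coordinate space; this
  adds one pivot, one basis vector and a factor q to the cardinality.\<close>

lemma subspace_card_basis:
  fixes X :: "(nat \<Rightarrow> 'a::{field,finite}) set"
  assumes "X \<subseteq> coord_space i" "fvec.subspace X"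
  shows "finite X \<and> card X = CARD('a) ^ card (pivots X) \<and>
    (\<exists>B. fvec.independent B \<and> finite B \<and> fvec.span B = X \<and> card B = card (pivots X))"
  using assms
proof (induction i arbitrary: X)
  case 0
  then have "X = {0}" using fvec.subspace_0 by (auto simp: coord_space_0)
  then show ?case
    by (auto simp: pivots_zero intro!: exI[of _ "{}"] fvec.independent_empty)
next
  case (Suc i)
  define Y where "Y = X \<inter> coord_space i"
  have Y: "Y \<subseteq> coord_space i" "fvec.subspace Y"
    using Suc.prems by (auto simp: Y_def intro: fvec.subspace_inter subspace_coord_space)
  show ?case
  proof (cases "\<forall>v\<in>X. v (Suc i) = 0")
    case True
    then have "X \<subseteq> coord_space i" using Suc.prems coord_space_SucD by blast
    then show ?thesis using Suc by blast
  next
    case False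
    then obtain u where u: "u \<in> X" "u (Suc i) \<noteq> 0" by blast
    \<comment> \<open>Normalized to have last coordinate 1, so that the multiple of \<open>v\<close>
      to subtract from \<open>x\<close> is \<open>x (Suc i)\<close>.\<close>
    define v where "v = scale_vec (inverse (u (Suc i))) u"
    have v: "v \<in> X" "v (Suc i) = 1"
      using u fvec.subspace_scale[OF Suc.prems(2) u(1)] by (simp_all add: v_def scale_vec_def)
    have in_Y: "x - scale_vec c v \<in> Y \<longleftrightarrow> x \<in> X \<and> c = x (Suc i)" for x c
    proof
      assume a: "x - scale_vec c v \<in> Y"
      then have "x - scale_vec c v \<in> X" by (simp add: Y_def)
      then have "(x - scale_vec c v) + scale_vec c v \<in> X"
        using v Suc.prems fvec.subspace_add fvec.subspace_scale by blast
      moreover have "(x - scale_vec c v) (Suc i) = 0"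
        using a by (auto simp: Y_def coord_space_def)
      ultimately show "x \<in> X \<and> c = x (Suc i)" using v(2) by (simp add: scale_vec_def)
    next
      assume a: "x \<in> X \<and> c = x (Suc i)"
      then have "x - scale_vec c v \<in> X"
        using v Suc.prems fvec.subspace_diff fvec.subspace_scale by blast
      moreover have "(x - scale_vec c v) (Suc i) = 0"
        using a v(2) by (simp add: scale_vec_def)
      ultimately show "x - scale_vec c v \<in> Y"
        using Suc.prems(1) coord_space_SucD[of "x - scale_vec c v"] by (simp add: Y_def subset_iff)
    qed
    obtain B where IH: "finite Y" "card Y = CARD('a) ^ card (pivots Y)" "fvec.independent B" "finite B"
      "fvec.span B = Y" "card B = card (pivots Y)"
      using Suc.IH[OF Y] by blast
    have piv: "pivots X = insert (Suc i) (pivots Y)"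
    proof -
      have "rightmost v = Suc i"
        using v Suc.prems by (intro rightmost_eqI) (auto simp: coord_space_def)
      moreover have "v \<noteq> 0" using v(2) by auto
      ultimately have "Suc i \<in> pivots X" using v(1) unfolding pivots_def by (metis DiffI imageI singletonD)
      moreover have "pivots Y = pivots X \<inter> {..i}"
        unfolding Y_def by (rule pivots_Int_coord_space) (rule Suc.prems)
      ultimately show ?thesis
        using pivots_subset[OF Suc.prems(1)] by (fastforce simp: le_Suc_eq)
    qed
    have "finite (pivots Y)" "Suc i \<notin> pivots Y"
      using pivots_subset[OF Y(1)] finite_pivots[OF Y(1)] by auto
    then have card_piv: "card (pivots X) = Suc (card (pivots Y))" by (simp add: piv)
    have "bij_betw (\<lambda>(c, y). y + scale_vec c v) (UNIV \<times> Y) X"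
    proof (rule bij_betw_byWitness[of _ "\<lambda>x. (x (Suc i), x - scale_vec (x (Suc i)) v)"])
      have y0: "y (Suc i) = 0" if "y \<in> Y" for y
        using that by (auto simp: Y_def coord_space_def)
      show "\<forall>a\<in>UNIV \<times> Y. (\<lambda>x. (x (Suc i), x - scale_vec (x (Suc i)) v)) ((\<lambda>(c, y). y + scale_vec c v) a) = a"
        using y0 v(2) by (auto simp: scale_vec_def fun_eq_iff)
      show "\<forall>x\<in>X. (\<lambda>(c, y). y + scale_vec c v) (x (Suc i), x - scale_vec (x (Suc i)) v) = x" by simp
      show "(\<lambda>(c, y). y + scale_vec c v) ` (UNIV \<times> Y) \<subseteq> X"
      proof clarify
        fix c y assume "y \<in> Y"
        then show "y + scale_vec c v \<in> X"
          using in_Y[of "y + scale_vec c v" c] by simp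
      qed
      show "(\<lambda>x. (x (Suc i), x - scale_vec (x (Suc i)) v)) ` X \<subseteq> UNIV \<times> Y"
        using in_Y by auto
    qed
    then have "card X = CARD('a) * card Y" "finite X"
      using bij_betw_same_card bij_betw_finite IH(1) by (fastforce simp: card_cartesian_product)+
    moreover have "fvec.span (insert v B) = X"
      using in_Y IH(5) by (auto simp: fvec.span_breakdown_eq)
    moreover have "v \<notin> fvec.span B"
    proof
      assume "v \<in> fvec.span B"
      then have "v \<in> coord_space i" using IH(5) Y(1) by blast
      then show False using v(2) by (simp add: coord_space_def)
    qed
    then have "fvec.independent (insert v B)" "v \<notin> B"
      using IH(3) fvec.independent_insertI fvec.span_base by blast+
    ultimately show ?thesis
      using IH card_piv by (auto intro!: exI[of _ "insert v B"])
  qed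
qed

section \<open>Adjoining a vector and counting covers\<close>

context
  fixes X :: "(nat \<Rightarrow> 'a::{field,finite}) set" and i :: nat
  assumes X: "X \<in> subspace_lattice i"
begin

lemma lattice_subset: "X \<subseteq> coord_space i"
  and lattice_subspace: "fvec.subspace X"
  using X by (auto simp: subspace_lattice_def)

lemma finite_lattice_subspace: "finite X"
  and card_lattice_subspace: "card X = CARD('a) ^ card (pivots X)"
  using subspace_card_basis[OF lattice_subset lattice_subspace] by auto

lemma lattice_finite_pivots: "finite (pivots X)"
  using finite_pivots[OF lattice_subset] .

lemma dim_eq_card_pivots: "fvec.dim X = card (pivots X)"
proof -
  obtain B where "fvec.independent B" "fvec.span B = X" "card B = card (pivots X)"
    using subspace_card_basis[OF lattice_subset lattice_subspace] by blast
  then show ?thesis using fvec.dim_span_eq_card_independent by metis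
qed

text \<open>The span keeps the old pivots and gains \<open>rightmost v\<close>. Its dimension grows
  by only one, and dimension is the number of pivots, so there is no room for another.\<close>

lemma adjoin_vector:
  assumes "v \<in> coord_space i" "v \<noteq> 0" "rightmost v \<notin> pivots X"
  shows "fvec.span (insert v X) \<in> subspace_lattice i"
    and "pivots (fvec.span (insert v X)) = insert (rightmost v) (pivots X)"
proof -
  let ?Y = "fvec.span (insert v X)"
  show Y: "?Y \<in> subspace_lattice i"
    using assms(1) lattice_subset fvec.subspace_span
      fvec.span_minimal[OF _ subspace_coord_space, of "insert v X" i]
    by (simp add: subspace_lattice_def)
  obtain B where B: "fvec.independent B" "finite B" "fvec.span B = X" "card B = card (pivots X)"
    using subspace_card_basis[OF lattice_subset lattice_subspace] by blast
  have "v \<notin> fvec.span B" using assms(2,3) B(3) by (auto simp: pivots_def)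
  then have ind: "fvec.independent (insert v B)" "v \<notin> B"
    using B(1) fvec.independent_insertI fvec.span_base by blast+
  have "?Y = fvec.span (insert v B)"
    using B(3) by (auto simp: fvec.span_breakdown_eq fvec.span_span)
  then have Y_piv: "fvec.dim ?Y = Suc (card (pivots X))"
    using fvec.dim_span_eq_card_independent[OF ind(1)] ind(2) B by simp
  obtain C where "fvec.independent C" "fvec.span C = ?Y" "card C = card (pivots ?Y)"
    using subspace_card_basis[of ?Y i] Y by (auto simp: subspace_lattice_def)
  then have card_Y: "card (pivots ?Y) = Suc (card (pivots X))"
    using fvec.dim_span_eq_card_independent Y_piv by metis
  have "finite (pivots ?Y)"
    using Y finite_pivots by (auto simp: subspace_lattice_def)
  moreover have "insert (rightmost v) (pivots X) \<subseteq> pivots ?Y"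
    using assms(2) pivots_mono[of X ?Y] fvec.span_base[of _ "insert v X"] by (auto simp: pivots_def)
  ultimately show "pivots ?Y = insert (rightmost v) (pivots X)"
    using card_Y assms(3) lattice_finite_pivots by (intro card_seteq[symmetric]) auto
qed

end

lemma lattice_eqI:
  fixes X Y :: "(nat \<Rightarrow> 'a::{field,finite}) set"
  assumes "X \<in> subspace_lattice i" "Y \<in> subspace_lattice i" "X \<subseteq> Y"
    "card (pivots Y) \<le> card (pivots X)"
  shows "X = Y"
proof (rule card_seteq)
  show "card Y \<le> card X"
    using assms(4) by (simp add: card_lattice_subspace[OF assms(1)] card_lattice_subspace[OF assms(2)]
      power_increasing)
qed (use assms finite_lattice_subspace in auto)

lemma zero_in_lattice: "{0} \<in> subspace_lattice i"
  by (auto simp: subspace_lattice_def coord_space_def fvec.subspace_def)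

lemma coord_space_in_lattice: "coord_space i \<in> subspace_lattice i"
  by (auto simp: subspace_lattice_def subspace_coord_space)

lemma Int_coord_space_in_lattice:
  "X \<in> subspace_lattice i \<Longrightarrow> X \<inter> coord_space j \<in> subspace_lattice i"
  by (auto simp: subspace_lattice_def intro: fvec.subspace_inter subspace_coord_space)

lemma CARD_field_gt_1: "CARD('a::{field,finite}) > 1"
proof -
  have "card {0, 1 :: 'a} \<le> CARD('a)" by (rule card_mono) auto
  then show ?thesis by simp
qed

text \<open>
  Counting the vectors with rightmost nonzero coordinate \<open>j\<close>: each of them lies in exactly one of
  the subspaces \<open>Y\<close> in question, and each such \<open>Y\<close> contains equally many of them.
\<close>

lemma card_covers_with_label:
  fixes X :: "(nat \<Rightarrow> 'a::{field,finite}) set"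
  assumes X: "X \<in> subspace_lattice i" and j: "j \<in> {1..i}" "j \<notin> pivots X"
  shows "card {Y \<in> subspace_lattice i. X \<subseteq> Y \<and> pivots Y = insert j (pivots X)} =
    CARD('a) ^ card {k \<in> {1..i} - pivots X. k < j}"
proof -
  let ?q = "CARD('a)"
  define cov where "cov = {Y \<in> subspace_lattice i. X \<subseteq> Y \<and> pivots Y = insert j (pivots X)}"
  define R where "R = {v \<in> coord_space i. v \<noteq> (0 :: nat \<Rightarrow> 'a) \<and> rightmost v = j}"
  define p where "p = card (pivots X \<inter> {..<j})"
  define r where "r = card {k \<in> {1..i} - pivots X. k < j}"
  have R_eq: "Y \<inter> R = Y \<inter> coord_space j - Y \<inter> coord_space (j - 1)" if "Y \<subseteq> coord_space i" for Y
  proof -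
    have "v \<in> R \<longleftrightarrow> v \<in> coord_space j - coord_space (j - 1)" if v: "v \<in> coord_space i" for v
    proof (cases "v = 0")
      case True
      then show ?thesis by (auto simp: R_def coord_space_def)
    next
      case False
      then show ?thesis
        using rightmost_le_iff[OF v False, of j] rightmost_le_iff[OF v False, of "j - 1"] v j(1)
        by (auto simp: R_def)
    qed
    then show ?thesis using that by blast
  qed
  have card_R: "card (Y \<inter> R) = ?q ^ card (pivots Y \<inter> {..j}) - ?q ^ card (pivots Y \<inter> {..j - 1})"
    if "Y \<in> subspace_lattice i" for Y
  proof -
    have sub: "Y \<subseteq> coord_space i" using that by (rule lattice_subset)
    have "card (Y \<inter> R) = card (Y \<inter> coord_space j) - card (Y \<inter> coord_space (j - 1))"
      unfolding R_eq[OF sub]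
      using coord_space_mono[of "j - 1" j] finite_lattice_subspace[OF that]
      by (intro card_Diff_subset) auto
    then show ?thesis
      by (simp add: card_lattice_subspace[OF Int_coord_space_in_lattice[OF that]] pivots_Int_coord_space[OF sub])
  qed
  have lt: "{..j - 1} = {..<j}" using j(1) by auto
  have "card R = ?q ^ j - ?q ^ (j - 1)"
  proof -
    have "coord_space i \<inter> R = R" by (auto simp: R_def)
    moreover have "{1..i} \<inter> {..j} = {1..j}" "{1..i} \<inter> {..j - 1} = {1..j - 1}" using j(1) by auto
    ultimately show ?thesis
      using card_R[OF coord_space_in_lattice] by (simp only: pivots_coord_space) simp
  qed
  moreover have "card R = card cov * (?q ^ Suc p - ?q ^ p)"
  proof -
    have "R = (\<Union>Y\<in>cov. Y \<inter> R)"
    proof (intro equalityI subsetI)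
      fix v assume v: "v \<in> R"
      then have "fvec.span (insert v X) \<in> cov"
        using adjoin_vector[OF X, of v] j(2) fvec.span_base[of _ "insert v X"]
        by (auto simp: R_def cov_def)
      moreover have "v \<in> fvec.span (insert v X)" by (simp add: fvec.span_base)
      ultimately show "v \<in> (\<Union>Y\<in>cov. Y \<inter> R)" using v by blast
    qed auto
    moreover have "card (\<Union>Y\<in>cov. Y \<inter> R) = (\<Sum>Y\<in>cov. card (Y \<inter> R))"
    proof (rule card_UN_disjoint)
      have "cov \<subseteq> Pow (coord_space i)" by (auto simp: cov_def dest: lattice_subset)
      then show "finite cov"
        using finite_lattice_subspace[OF coord_space_in_lattice[where 'a = 'a]]
        by (meson finite_Pow_iff finite_subset)
      show "\<forall>Y\<in>cov. finite (Y \<inter> R)"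
        by (auto simp: cov_def dest: finite_lattice_subspace)
      show "\<forall>Y\<in>cov. \<forall>Z\<in>cov. Y \<noteq> Z \<longrightarrow> (Y \<inter> R) \<inter> (Z \<inter> R) = {}"
      proof (intro ballI impI, rule ccontr)
        fix Y Z assume YZ: "Y \<in> cov" "Z \<in> cov" "Y \<noteq> Z" "(Y \<inter> R) \<inter> (Z \<inter> R) \<noteq> {}"
        then obtain v where v: "v \<in> Y" "v \<in> Z" "v \<in> R" by blast
        \<comment> \<open>Any such \<open>W\<close> contains the span and has the same number of
          pivots, hence equals it. So \<open>v\<close> determines the member of \<open>cov\<close>
          that contains it.\<close>
        have "fvec.span (insert v X) = W" if "W \<in> cov" "v \<in> W" for W
        proof (rule lattice_eqI)
          show "fvec.span (insert v X) \<in> subspace_lattice i"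
            "card (pivots W) \<le> card (pivots (fvec.span (insert v X)))"
            using adjoin_vector[OF X, of v] v(3) j(2) that by (auto simp: R_def cov_def)
          show "W \<in> subspace_lattice i" using that by (simp add: cov_def)
          show "fvec.span (insert v X) \<subseteq> W"
            using that by (intro fvec.span_minimal) (auto simp: cov_def subspace_lattice_def)
        qed
        then show False using YZ v by metis
      qed
    qed
    \<comment> \<open>Below \<open>j\<close> the pivots of \<open>Y\<close> are the \<open>p\<close>
      pivots of \<open>X\<close>, and \<open>j\<close> is one more. So \<open>Y\<close> has q^(p+1)
      vectors in \<open>coord_space j\<close>, of which q^p lie in
      \<open>coord_space (j - 1)\<close>.\<close>
    moreover have "card (Y \<inter> R) = ?q ^ Suc p - ?q ^ p" if "Y \<in> cov" for Y
    proof -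
      have Y: "Y \<in> subspace_lattice i" "pivots Y = insert j (pivots X)" using that by (auto simp: cov_def)
      have "pivots Y \<inter> {..j - 1} = pivots X \<inter> {..<j}" using Y(2) lt by auto
      moreover have "pivots Y \<inter> {..j} = insert j (pivots X \<inter> {..<j})" using Y(2) by auto
      moreover have "card (insert j (pivots X \<inter> {..<j})) = Suc p" by (simp add: p_def)
      ultimately show ?thesis using card_R[OF Y(1)] by (simp add: p_def)
    qed
    ultimately show ?thesis by simp
  qed
  moreover have "j - 1 = r + p"
  proof -
    have "{1..<j} = {k \<in> {1..i} - pivots X. k < j} \<union> (pivots X \<inter> {..<j})"
      using j pivots_subset[OF lattice_subset[OF X]] by auto
    moreover have "card ({k \<in> {1..i} - pivots X. k < j} \<union> (pivots X \<inter> {..<j})) = r + p"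
      unfolding r_def p_def by (rule card_Un_disjoint) auto
    ultimately show ?thesis by (metis card_atLeastLessThan)
  qed
  then have "j = Suc (r + p)" using j(1) by (simp; linarith)
  \<comment> \<open>The two counts of \<open>R\<close> give q^(r+p+1) - q^(r+p) =
    \<open>card cov\<close> * (q^(p+1) - q^p). The common factor q^p * (q - 1) can be cancelled
    because q > 1.\<close>
  ultimately have "card cov * (?q ^ p * (?q - 1)) = ?q ^ r * (?q ^ p * (?q - 1))"
    by (simp add: power_add algebra_simps)
  then show ?thesis
    using CARD_field_gt_1[where 'a = 'a] by (simp add: cov_def r_def)
qed

section \<open>Edge labels as new pivots\<close>

lemma line_index_eqI:
  assumes "pivots L = {j}"
  shows "line_index L = j"
proof -
  have "(\<exists>v\<in>L. v \<noteq> 0 \<and> k = rightmost v) \<longleftrightarrow> k \<in> pivots L" for k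
    by (auto simp: pivots_def)
  then show ?thesis by (simp add: line_index_def assms)
qed

text \<open>A line has a single pivot, which is its index; conversely each nonzero vector of X spans
  a line in X whose index is its rightmost coordinate.\<close>

lemma line_index_lines:
  fixes X :: "(nat \<Rightarrow> 'a::{field,finite}) set"
  assumes X: "X \<in> subspace_lattice i"
  shows "line_index ` lines X = pivots X"
proof (intro equalityI subsetI)
  fix j assume "j \<in> line_index ` lines X"
  then obtain L where L: "fvec.subspace L" "fvec.dim L = 1" "L \<subseteq> X" "j = line_index L"
    by (auto simp: lines_def)
  then have "L \<in> subspace_lattice i" using X by (auto simp: subspace_lattice_def)
  then obtain k where "pivots L = {k}"
    using L(2) by (auto simp: dim_eq_card_pivots card_1_singleton_iff)
  then show "j \<in> pivots X"
    using L(4) line_index_eqI pivots_mono[OF L(3)] by blast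
next
  fix j assume "j \<in> pivots X"
  then obtain v where v: "v \<in> X" "v \<noteq> 0" "j = rightmost v" by (auto simp: pivots_def)
  let ?L = "fvec.span (insert v {0})"
  have "v \<in> coord_space i" using v(1) lattice_subset[OF X] by blast
  then have L: "?L \<in> subspace_lattice i" "pivots ?L = {j}"
    using adjoin_vector[OF zero_in_lattice[of i], of v] v by (auto simp: pivots_zero)
  then have "fvec.dim ?L = 1" using dim_eq_card_pivots[OF L(1)] by (simp del: fvec.dim_span)
  moreover have "?L \<subseteq> X"
    using v(1) lattice_subspace[OF X] fvec.subspace_0 by (intro fvec.span_minimal) auto
  ultimately have "?L \<in> lines X" using fvec.subspace_span unfolding lines_def by blast
  then show "j \<in> line_index ` lines X" using line_index_eqI[OF L(2)] by blast
qed

text \<open>Stated through dimension, so that it can be checked between neighbours of a list.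
  \<open>exists_cover_below\<close> ties it to the order.\<close>

definition covered_by :: "(nat \<Rightarrow> 'a::field) set \<Rightarrow> (nat \<Rightarrow> 'a) set \<Rightarrow> bool" where
  "covered_by X Y \<longleftrightarrow> X \<subseteq> Y \<and> fvec.dim Y = Suc (fvec.dim X)"

lemma covered_by_edge_label_iff:
  fixes X Y :: "(nat \<Rightarrow> 'a::{field,finite}) set"
  assumes X: "X \<in> subspace_lattice i" and Y: "Y \<in> subspace_lattice i"
  shows "covered_by X Y \<and> edge_label X Y = j \<longleftrightarrow> X \<subseteq> Y \<and> j \<notin> pivots X \<and> pivots Y = insert j (pivots X)"
proof -
  have label: "edge_label X Y = the_elem (pivots Y - pivots X)"
    by (simp add: edge_label_def line_index_lines[OF X] line_index_lines[OF Y])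
  show ?thesis
  proof
    assume a: "covered_by X Y \<and> edge_label X Y = j"
    then have "X \<subseteq> Y" "card (pivots Y) = Suc (card (pivots X))"
      by (auto simp: covered_by_def dim_eq_card_pivots[OF X] dim_eq_card_pivots[OF Y])
    moreover from this have "card (pivots Y - pivots X) = 1"
      using pivots_mono[of X Y] lattice_finite_pivots[OF X] by (simp add: card_Diff_subset)
    then obtain k where "pivots Y - pivots X = {k}" by (auto simp: card_1_singleton_iff)
    moreover from this have "k = j" using a label by simp
    ultimately show "X \<subseteq> Y \<and> j \<notin> pivots X \<and> pivots Y = insert j (pivots X)"
      using pivots_mono[of X Y] by auto
  next
    assume a: "X \<subseteq> Y \<and> j \<notin> pivots X \<and> pivots Y = insert j (pivots X)"
    then have "pivots Y - pivots X = {j}" by auto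
    then show "covered_by X Y \<and> edge_label X Y = j"
      using a lattice_finite_pivots[OF X]
      by (simp add: label covered_by_def dim_eq_card_pivots[OF X] dim_eq_card_pivots[OF Y])
  qed
qed

section \<open>Flags and maximal chains\<close>

lemma label_sequence_simps [simp]:
  "label_sequence lab [] = []"
  "label_sequence lab [x] = []"
  "label_sequence lab (x # y # cs) = lab x y # label_sequence lab (y # cs)"
  by (simp_all add: label_sequence_def)

lemma length_label_sequence [simp]: "length (label_sequence lab cs) = length cs - 1"
  by (simp add: label_sequence_def)

text \<open>The lower end is arbitrary, so that an induction can drop the first subspace; complete
  flags are those from \<open>{0}\<close>.\<close>

definition flags :: "nat \<Rightarrow> (nat \<Rightarrow> 'a::field) set \<Rightarrow> (nat \<Rightarrow> 'a) set list set" where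
  "flags i X = {cs. cs \<noteq> [] \<and> set cs \<subseteq> subspace_lattice i \<and> hd cs = X \<and>
     last cs = coord_space i \<and> successively covered_by cs}"

lemma flags_Cons_Cons_iff:
  "X' # Y # cs \<in> flags i X \<longleftrightarrow>
     X' = X \<and> X \<in> subspace_lattice i \<and> covered_by X Y \<and> Y # cs \<in> flags i Y"
  by (auto simp: flags_def)

text \<open>The letters of the word are the non-pivots of X. The first letter \<open>j\<close>
  leaves q^r choices for the next subspace, with r the number of smaller letters in the rest of the
  word, and by induction every choice has equally many continuations.\<close>

lemma card_flags_with_labels:
  fixes X :: "(nat \<Rightarrow> 'a::{field,finite}) set"
  assumes "X \<in> subspace_lattice i" "distinct w" "set w = {1..i} - pivots X"
  shows "card {cs \<in> flags i X. label_sequence edge_label cs = w} = CARD('a) ^ inversions w"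
  using assms
proof (induction w arbitrary: X)
  case Nil
  then have "pivots X = {1..i}" using pivots_subset[OF lattice_subset[OF Nil(1)]] by auto
  then have "X = coord_space i"
    using Nil lattice_subset by (intro lattice_eqI[OF _ coord_space_in_lattice]) (auto simp: pivots_coord_space)
  have "{cs \<in> flags i X. label_sequence edge_label cs = []} = {[X]}"
  proof (intro equalityI subsetI)
    fix cs assume cs: "cs \<in> {cs \<in> flags i X. label_sequence edge_label cs = []}"
    then have "length cs - 1 = 0"
      using length_label_sequence[of edge_label cs] by simp
    then show "cs \<in> {[X]}" using cs by (cases cs) (auto simp: flags_def)
  qed (use Nil \<open>X = coord_space i\<close> in \<open>auto simp: flags_def\<close>)
  then show ?case by simp
next
  case (Cons j w)
  define cov where "cov = {Y \<in> subspace_lattice i. X \<subseteq> Y \<and> pivots Y = insert j (pivots X)}"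
  define F where "F Y = {cs \<in> flags i Y. label_sequence edge_label cs = w}" for Y :: "(nat \<Rightarrow> 'a) set"
  have j: "j \<in> {1..i}" "j \<notin> pivots X" using Cons.prems(3) by auto
  have cov: "Y \<in> cov \<longleftrightarrow> Y \<in> subspace_lattice i \<and> covered_by X Y \<and> edge_label X Y = j" for Y
    using covered_by_edge_label_iff[OF Cons.prems(1), of Y j] j(2) by (auto simp: cov_def)
  have F: "card (F Y) = CARD('a) ^ inversions w" if "Y \<in> cov" for Y
    unfolding F_def
  proof (rule Cons.IH)
    show "Y \<in> subspace_lattice i" "distinct w" using that Cons.prems by (auto simp: cov_def)
    show "set w = {1..i} - pivots Y" using that Cons.prems by (auto simp: cov_def)
  qed
  have "{cs \<in> flags i X. label_sequence edge_label cs = j # w} = (\<Union>Y\<in>cov. (#) X ` F Y)" (is "?L = ?R")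
  proof (intro equalityI subsetI)
    fix cs assume cs: "cs \<in> ?L"
    then obtain X' Y ds where ds: "cs = X' # Y # ds"
      by (cases cs rule: remdups_adj.cases) auto
    then have "Y \<in> cov" "Y # ds \<in> F Y" "X' = X"
      using cs by (auto simp: flags_Cons_Cons_iff cov F_def) (auto simp: flags_def)
    then show "cs \<in> ?R" using ds by blast
  next
    fix cs assume "cs \<in> ?R"
    then obtain Y ds where Y: "Y \<in> cov" "ds \<in> F Y" "cs = X # ds" by blast
    then obtain ds' where "ds = Y # ds'" by (cases ds) (auto simp: F_def flags_def)
    then show "cs \<in> ?L" using Y Cons.prems(1) by (auto simp: F_def flags_Cons_Cons_iff cov)
  qed
  moreover have "card (\<Union>Y\<in>cov. (#) X ` F Y) = (\<Sum>Y\<in>cov. card ((#) X ` F Y))"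
  proof (rule card_UN_disjoint)
    have "cov \<subseteq> Pow (coord_space i)" by (auto simp: cov_def dest: lattice_subset)
    then show "finite cov"
      using finite_lattice_subspace[OF coord_space_in_lattice[where 'a = 'a]]
      by (meson finite_Pow_iff finite_subset)
    show "\<forall>Y\<in>cov. finite ((#) X ` F Y)"
    proof
      fix Y assume "Y \<in> cov"
      \<comment> \<open>An infinite set has \<open>card\<close> 0, so the known positive count
        yields finiteness.\<close>
      then have "card (F Y) > 0" by (simp add: F)
      then show "finite ((#) X ` F Y)" by (intro finite_imageI) (rule card_ge_0_finite)
    qed
    show "\<forall>Y\<in>cov. \<forall>Z\<in>cov. Y \<noteq> Z \<longrightarrow> (#) X ` F Y \<inter> (#) X ` F Z = {}"
      by (auto simp: F_def flags_def)
  qed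
  moreover have "card ((#) X ` F Y) = CARD('a) ^ inversions w" if "Y \<in> cov" for Y
    using F[OF that] by (simp add: card_image)
  moreover have "card cov = CARD('a) ^ card {k \<in> set w. k < j}"
  proof -
    have "{k \<in> {1..i} - pivots X. k < j} = {k \<in> set w. k < j}"
      unfolding Cons.prems(3)[symmetric] by auto
    then show ?thesis using card_covers_with_label[OF Cons.prems(1) j] by (simp add: cov_def)
  qed
  ultimately show ?case by (simp add: power_add)
qed

text \<open>Each step adds its label to the pivots, so no label recurs, and at the top all of
  \<open>{1..i}\<close> has been reached.\<close>

lemma flag_labels_permutation:
  fixes X :: "(nat \<Rightarrow> 'a::{field,finite}) set"
  assumes "cs \<in> flags i X"
  shows "label_sequence edge_label cs \<in> permutations_of_set ({1..i} - pivots X)"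
  using assms
proof (induction cs arbitrary: X rule: induct_list012)
  case 1
  then show ?case by (simp add: flags_def)
next
  case (2 X')
  then have "X = coord_space i" by (auto simp: flags_def)
  then show ?case by (simp add: pivots_coord_space)
next
  case (3 X' Y cs)
  from 3(3) have *: "X' = X" "X \<in> subspace_lattice i" "covered_by X Y" "Y # cs \<in> flags i Y"
    by (auto simp: flags_Cons_Cons_iff)
  then have Y: "Y \<in> subspace_lattice i" by (auto simp: flags_def)
  let ?j = "edge_label X Y"
  have piv: "?j \<notin> pivots X" "pivots Y = insert ?j (pivots X)"
    using covered_by_edge_label_iff[OF *(2) Y, of ?j] *(3) by auto
  then have "?j \<in> {1..i}" using pivots_subset[OF lattice_subset[OF Y]] by auto
  then show ?case
    using 3(2)[OF *(4)] piv *(1) by (auto simp: permutations_of_set_def)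
qed

lemma dim_flag_nth:
  fixes cs :: "(nat \<Rightarrow> 'a::field) set list"
  assumes "cs \<in> flags i {0}" "k < length cs"
  shows "fvec.dim (cs ! k) = k"
  using assms(2)
proof (induction k)
  case 0
  have "fvec.dim ({0} :: (nat \<Rightarrow> 'a) set) = 0"
    using fvec.dim_span_eq_card_independent[OF fvec.independent_empty] by simp
  then show ?case using assms by (auto simp: flags_def hd_conv_nth)
next
  case (Suc k)
  then have "covered_by (cs ! k) (cs ! Suc k)"
    using assms(1) by (auto simp: flags_def intro: successively_nth)
  then show ?case using Suc by (simp add: covered_by_def)
qed

lemma length_flag:
  fixes cs :: "(nat \<Rightarrow> 'a::{field,finite}) set list"
  assumes "cs \<in> flags i {0}"
  shows "length cs = Suc i"
proof -
  have "length (label_sequence edge_label cs) = i"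
    using length_finite_permutations_of_set[OF flag_labels_permutation[OF assms]]
    by (simp add: pivots_zero)
  moreover have "cs \<noteq> []" using assms by (simp add: flags_def)
  ultimately show ?thesis by (cases cs) auto
qed

section \<open>Maximal chains of the Segre product\<close>

lemma lattice_dim_mono:
  fixes X Y :: "(nat \<Rightarrow> 'a::{field,finite}) set"
  assumes "X \<in> subspace_lattice i" "Y \<in> subspace_lattice i" "X \<subseteq> Y"
  shows "fvec.dim X \<le> fvec.dim Y"
  using pivots_mono[OF assms(3)] lattice_finite_pivots[OF assms(2)]
  by (simp add: dim_eq_card_pivots[OF assms(1)] dim_eq_card_pivots[OF assms(2)] card_mono)

lemma lattice_dim_le:
  fixes X :: "(nat \<Rightarrow> 'a::{field,finite}) set"
  assumes "X \<in> subspace_lattice i"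
  shows "fvec.dim X \<le> i"
  using card_mono[OF _ pivots_subset[OF lattice_subset[OF assms]]]
  by (simp add: dim_eq_card_pivots[OF assms])

lemma segre_eqI:
  fixes x y :: "(nat \<Rightarrow> 'a::{field,finite}) set \<times> (nat \<Rightarrow> 'a) set"
  assumes "x \<in> segre_subspaces i" "y \<in> segre_subspaces i" "x \<le> y"
    "fvec.dim (fst y) \<le> fvec.dim (fst x)"
  shows "x = y"
proof -
  have *: "fst x \<in> subspace_lattice i" "snd x \<in> subspace_lattice i" "fvec.dim (fst x) = fvec.dim (snd x)"
    "fst y \<in> subspace_lattice i" "snd y \<in> subspace_lattice i" "fvec.dim (fst y) = fvec.dim (snd y)"
    using assms(1,2) by (auto simp: segre_subspaces_def segre_product_def)
  have "fst x \<subseteq> fst y" "snd x \<subseteq> snd y" using assms(3) by (auto simp: less_eq_prod_def)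
  then have "fst x = fst y" "snd x = snd y"
    using lattice_eqI[OF *(1,4)] lattice_eqI[OF *(2,5)] assms(4) *
    by (simp_all add: dim_eq_card_pivots)
  then show ?thesis by (simp add: prod_eq_iff)
qed

text \<open>Proper inclusion means that \<open>Y\<close> has a pivot missing in \<open>X\<close>;
  adjoining a vector of \<open>Y\<close> with that pivot gives the cover.\<close>

lemma exists_cover_below:
  fixes X Y :: "(nat \<Rightarrow> 'a::{field,finite}) set"
  assumes X: "X \<in> subspace_lattice i" and Y: "Y \<in> subspace_lattice i" and "X \<subset> Y"
  obtains Z where "Z \<in> subspace_lattice i" "covered_by X Z" "Z \<subseteq> Y"
proof -
  have "pivots X \<noteq> pivots Y"
    using lattice_eqI[OF X Y] assms(3) by auto
  then obtain v where v: "v \<in> Y" "v \<noteq> 0" "rightmost v \<notin> pivots X"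
    using pivots_mono[of X Y] assms(3) by (auto simp: pivots_def)
  let ?Z = "fvec.span (insert v X)"
  have "v \<in> coord_space i" using v(1) lattice_subset[OF Y] by blast
  then have Z: "?Z \<in> subspace_lattice i" "pivots ?Z = insert (rightmost v) (pivots X)"
    using adjoin_vector[OF X _ v(2,3)] by auto
  moreover have "X \<subseteq> ?Z" using fvec.span_base[of _ "insert v X"] by blast
  then have "covered_by X ?Z"
    using covered_by_edge_label_iff[OF X Z(1), of "rightmost v"] Z(2) v(3) by blast
  moreover have "?Z \<subseteq> Y"
    using v(1) assms(3) lattice_subspace[OF Y] by (intro fvec.span_minimal) auto
  ultimately show ?thesis using that by blast
qed

lemma maximal_chains_comparable_mem:
  assumes "cs \<in> maximal_chains P" "z \<in> P" "\<And>x. x \<in> set cs \<Longrightarrow> x \<le> z \<or> z \<le> x"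
  shows "z \<in> set cs"
proof (rule ccontr)
  assume "z \<notin> set cs"
  have m: "pred_on.maxchain P (<) (set cs)" using assms(1) by (simp add: maximal_chains_def)
  then have "pred_on.chain P (<) (set cs)" by (simp add: pred_on.maxchain_def)
  then have "pred_on.chain P (<) (insert z (set cs))"
    using assms(2,3) by (auto simp: pred_on.chain_def order_le_less)
  moreover have "set cs \<subset> insert z (set cs)" using \<open>z \<notin> set cs\<close> by auto
  ultimately show False using m unfolding pred_on.maxchain_def by blast
qed

text \<open>Bottom and top are comparable with everything, so they belong to the chain. Between
  neighbours, equality of dimensions makes the inclusion proper in both coordinates or in neither,
  so both can be refined at once; the refined pair again has equal dimensions and lies in the Segre
  product.\<close>

lemma maximal_chains_segre_flags:
  fixes cs :: "((nat \<Rightarrow> 'a::{field,finite}) set \<times> (nat \<Rightarrow> 'a) set) list"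
  assumes cs: "cs \<in> maximal_chains (segre_subspaces i)"
  shows "map fst cs \<in> flags i {0} \<and> map snd cs \<in> flags i {0}"
proof -
  let ?P = "segre_subspaces i :: ((nat \<Rightarrow> 'a) set \<times> (nat \<Rightarrow> 'a) set) set"
  have sorted: "sorted_wrt (<) cs" and sub: "set cs \<subseteq> ?P"
    using cs by (auto simp: maximal_chains_def pred_on.maxchain_def pred_on.chain_def)
  have P: "fst x \<in> subspace_lattice i" "snd x \<in> subspace_lattice i" "fvec.dim (fst x) = fvec.dim (snd x)"
    if "x \<in> ?P" for x
    using that by (auto simp: segre_subspaces_def segre_product_def)
  have bot: "({0}, {0}) \<in> set cs"
  proof (rule maximal_chains_comparable_mem[OF cs])
    show "({0}, {0}) \<in> ?P" by (simp add: segre_subspaces_def segre_product_def zero_in_lattice)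
    show "x \<le> ({0}, {0}) \<or> ({0}, {0}) \<le> x" if "x \<in> set cs" for x
      using that sub P[of x] by (auto simp: less_eq_prod_def subspace_lattice_def dest: fvec.subspace_0)
  qed
  have top: "(coord_space i, coord_space i) \<in> set cs"
  proof (rule maximal_chains_comparable_mem[OF cs])
    show "(coord_space i, coord_space i) \<in> ?P"
      by (simp add: segre_subspaces_def segre_product_def coord_space_in_lattice)
    show "x \<le> (coord_space i, coord_space i) \<or> (coord_space i, coord_space i) \<le> x" if "x \<in> set cs" for x
      using that sub P[of x] by (auto simp: less_eq_prod_def subspace_lattice_def)
  qed
  have ne: "cs \<noteq> []" using bot by auto
  have hd: "hd cs = ({0}, {0})"
  proof (rule ccontr)
    assume a: "hd cs \<noteq> ({0}, {0})"
    obtain x xs where x: "cs = x # xs" using ne by (cases cs) auto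
    then have "x < ({0}, {0})" using a bot sorted by auto
    moreover have "({0}, {0}) \<le> x"
      using x sub P[of x] by (auto simp: less_eq_prod_def subspace_lattice_def dest: fvec.subspace_0)
    ultimately show False by simp
  qed
  have last: "last cs = (coord_space i, coord_space i)"
  proof (rule ccontr)
    assume a: "last cs \<noteq> (coord_space i, coord_space i)"
    obtain x xs where x: "cs = xs @ [x]" using ne by (cases cs rule: rev_cases) auto
    then have "(coord_space i, coord_space i) < x" using a top sorted by (auto simp: sorted_wrt_append)
    moreover have "x \<le> (coord_space i, coord_space i)"
      using x sub P[of x] by (auto simp: less_eq_prod_def subspace_lattice_def)
    ultimately show False by simp
  qed
  have cover: "covered_by (fst (cs ! k)) (fst (cs ! Suc k)) \<and> covered_by (snd (cs ! k)) (snd (cs ! Suc k))"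
    if k: "Suc k < length cs" for k
  proof -
    define x y where "x = cs ! k" and "y = cs ! Suc k"
    have "x < y" using sorted k by (simp add: x_def y_def sorted_wrt_nth_less)
    have xy: "x \<in> ?P" "y \<in> ?P" using sub k by (auto simp: x_def y_def)
    have le: "fst x \<subseteq> fst y" "snd x \<subseteq> snd y" using \<open>x < y\<close> by (auto simp: less_prod_def less_eq_prod_def)
    have "fvec.dim (fst x) < fvec.dim (fst y)"
      using segre_eqI[OF xy] \<open>x < y\<close> by (cases "fvec.dim (fst y) \<le> fvec.dim (fst x)") (auto simp: less_le)
    then have "fst x \<subset> fst y" "snd x \<subset> snd y" using le P(3)[OF xy(1)] P(3)[OF xy(2)] by auto
    obtain X where X: "X \<in> subspace_lattice i" "covered_by (fst x) X" "X \<subseteq> fst y"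
      using exists_cover_below[OF P(1)[OF xy(1)] P(1)[OF xy(2)] \<open>fst x \<subset> fst y\<close>] .
    obtain Y where Y: "Y \<in> subspace_lattice i" "covered_by (snd x) Y" "Y \<subseteq> snd y"
      using exists_cover_below[OF P(2)[OF xy(1)] P(2)[OF xy(2)] \<open>snd x \<subset> snd y\<close>] .
    have z: "(X, Y) \<in> ?P" "x \<le> (X, Y)" "(X, Y) \<le> y" "fvec.dim X = Suc (fvec.dim (fst x))"
      using X Y P(3)[OF xy(1)]
      by (auto simp: segre_subspaces_def segre_product_def less_eq_prod_def covered_by_def)
    have split: "a \<le> x \<or> y \<le> a" if a: "a \<in> set cs" for a
    proof -
      obtain m where m: "m < length cs" "a = cs ! m" using a by (auto simp: in_set_conv_nth)
      consider "m < k" | "m = k" | "m = Suc k" | "Suc k < m" by linarith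
      then show ?thesis
        using m k sorted_wrt_nth_less[OF sorted] by cases (auto simp: x_def y_def less_imp_le)
    qed
    \<comment> \<open>Lying between neighbours, the refined pair is comparable with the whole chain
      and so belongs to it. Its dimension excludes \<open>x\<close>, so it is \<open>y\<close>, and
      the step is a cover in both coordinates.\<close>
    have "(X, Y) \<in> set cs"
      using maximal_chains_comparable_mem[OF cs z(1)] split z(2,3) order_trans by blast
    then consider "(X, Y) \<le> x" | "y \<le> (X, Y)" using split by blast
    then have "(X, Y) = y"
    proof cases
      case 1
      then have "X \<subseteq> fst x" by (simp add: less_eq_prod_def)
      then show ?thesis using lattice_dim_mono[OF X(1) P(1)[OF xy(1)]] z(4) by simp
    qed (use z(3) in \<open>simp add: antisym\<close>)
    then have "fst y = X" "snd y = Y" by auto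
    then show ?thesis using X(2) Y(2) by (simp add: x_def y_def)
  qed
  show ?thesis
    using ne hd last cover sub P
    by (auto simp: flags_def successively_conv_nth hd_map last_map)
qed

text \<open>The chain has an element in every dimension up to \<open>i\<close>. An element of a
  larger chain is comparable with the one of its own dimension and therefore equal to it.\<close>

lemma flags_maximal_chains_segre:
  fixes cs :: "((nat \<Rightarrow> 'a::{field,finite}) set \<times> (nat \<Rightarrow> 'a) set) list"
  assumes c: "map fst cs \<in> flags i {0}" and d: "map snd cs \<in> flags i {0}"
  shows "cs \<in> maximal_chains (segre_subspaces i)"
proof -
  let ?P = "segre_subspaces i :: ((nat \<Rightarrow> 'a) set \<times> (nat \<Rightarrow> 'a) set) set"
  have len: "length cs = Suc i" using length_flag[OF c] by simp
  have dim: "fvec.dim (fst (cs ! k)) = k" "fvec.dim (snd (cs ! k)) = k" if "k < length cs" for k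
    using dim_flag_nth[OF c, of k] dim_flag_nth[OF d, of k] that by auto
  have sub: "set cs \<subseteq> ?P"
  proof
    fix x assume x: "x \<in> set cs"
    then have "fst x \<in> subspace_lattice i" "snd x \<in> subspace_lattice i" using c d by (auto simp: flags_def)
    moreover have "fvec.dim (fst x) = fvec.dim (snd x)" using x dim by (auto simp: in_set_conv_nth)
    ultimately show "x \<in> ?P" by (auto simp: segre_subspaces_def segre_product_def)
  qed
  have "successively (<) cs"
    unfolding successively_conv_nth
  proof (intro allI impI)
    fix k assume k: "Suc k < length cs"
    then have "covered_by (fst (cs ! k)) (fst (cs ! Suc k))" "covered_by (snd (cs ! k)) (snd (cs ! Suc k))"
      using c d by (auto simp: flags_def successively_conv_nth)
    then have "cs ! k \<le> cs ! Suc k" by (simp add: covered_by_def less_eq_prod_def)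
    moreover have "cs ! k \<noteq> cs ! Suc k" using dim(1)[of k] dim(1)[of "Suc k"] k by auto
    ultimately show "cs ! k < cs ! Suc k" by (rule le_neq_trans)
  qed
  then have sorted: "sorted_wrt (<) cs"
    by (simp add: successively_conv_sorted_wrt)
  have "x < y \<or> x = y \<or> y < x" if x: "x \<in> set cs" and y: "y \<in> set cs" for x y
  proof -
    obtain k where "k < length cs" "x = cs ! k" using x by (auto simp: in_set_conv_nth)
    moreover obtain l where "l < length cs" "y = cs ! l" using y by (auto simp: in_set_conv_nth)
    ultimately show ?thesis
      using sorted_wrt_nth_less[OF sorted, of k l] sorted_wrt_nth_less[OF sorted, of l k]
      by (cases k l rule: linorder_cases) auto
  qed
  then have chain: "pred_on.chain ?P (<) (set cs)" using sub by (auto simp: pred_on.chain_def)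
  have "\<not> set cs \<subset> S" if S: "pred_on.chain ?P (<) S" for S
  proof
    assume "set cs \<subset> S"
    then obtain z where z: "z \<in> S" "z \<notin> set cs" by blast
    then have "z \<in> ?P" using S by (auto simp: pred_on.chain_def)
    let ?k = "fvec.dim (fst z)"
    have "?k \<le> i"
      using \<open>z \<in> ?P\<close> by (auto simp: segre_subspaces_def segre_product_def intro: lattice_dim_le)
    then have k: "?k < length cs" using len by simp
    then have "cs ! ?k \<in> set cs" by (rule nth_mem)
    then have "cs ! ?k \<in> S" "cs ! ?k \<in> ?P" using \<open>set cs \<subset> S\<close> sub by blast+
    then have "z \<le> cs ! ?k \<or> cs ! ?k \<le> z"
      using S z(1) by (auto simp: pred_on.chain_def order_le_less)
    then have "z = cs ! ?k"
      using segre_eqI[OF \<open>z \<in> ?P\<close> \<open>cs ! ?k \<in> ?P\<close>] segre_eqI[OF \<open>cs ! ?k \<in> ?P\<close> \<open>z \<in> ?P\<close>] dim(1)[OF k]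
      by auto
    then show False using z(2) k by (metis nth_mem)
  qed
  then show ?thesis using chain sorted by (auto simp: maximal_chains_def pred_on.maxchain_def)
qed

section \<open>From chains to weighted pairs of words\<close>

lemma label_sequence_segre:
  "label_sequence segre_label cs =
     zip (label_sequence edge_label (map fst cs)) (label_sequence edge_label (map snd cs))"
  by (induction cs rule: induct_list012) (auto simp: segre_label_def)

lemma num_descending_chains_eq_weight:
  "real (num_descending_chains TYPE('a::{field,finite}) i) = descending_weight CARD('a) i"
proof (cases "i = 0")
  \<comment> \<open>The convention W_0 = 1 agrees with the weight of the single pair of empty
    words.\<close>
  case True
  then show ?thesis
    by (simp add: num_descending_chains_def descending_weight_def descending_def)
next
  case False
  let ?S = "permutations_of_set {1..i}"
  let ?lab = "label_sequence edge_label :: (nat \<Rightarrow> 'a) set list \<Rightarrow> nat list"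
  define D where "D = {cs \<in> maximal_chains
      (segre_subspaces i :: ((nat \<Rightarrow> 'a) set \<times> (nat \<Rightarrow> 'a) set) set). descending (label_sequence segre_label cs)}"
  define E where "E = {(s, t) \<in> ?S \<times> ?S. descending (zip s t)}"
  define F where "F w = {cs \<in> flags i {0 :: nat \<Rightarrow> 'a}. ?lab cs = w}" for w
  have card_F: "card (F w) = CARD('a) ^ inversions w" if "w \<in> ?S" for w
    unfolding F_def
    using that card_flags_with_labels[OF zero_in_lattice[of i], of w, where 'a = 'a]
    by (simp add: permutations_of_setD pivots_zero)
  have lab: "?lab c \<in> ?S" if "c \<in> flags i {0}" for c
    using flag_labels_permutation[OF that] by (simp add: pivots_zero)
  \<comment> \<open>Recording the pair of label words next to the pair of flags fibres the chains
    over the words, with fibres \<open>F s \<times> F t\<close> of known size.\<close>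
  have "bij_betw (\<lambda>cs. ((?lab (map fst cs), ?lab (map snd cs)), (map fst cs, map snd cs))) D
      (SIGMA p:E. F (fst p) \<times> F (snd p))"
  proof (rule bij_betw_byWitness[of _ "\<lambda>(_, c, d). zip c d"])
    show "\<forall>cs\<in>D. (\<lambda>(_, c, d). zip c d) ((?lab (map fst cs), ?lab (map snd cs)), (map fst cs, map snd cs)) = cs"
      by (simp add: zip_map_fst_snd)
    \<comment> \<open>All complete flags have \<open>i + 1\<close> members, so zipping two of them
      loses nothing.\<close>
    have len: "length c = length d" if "c \<in> F s" "d \<in> F t" for c d s t
      using that length_flag[of c i] length_flag[of d i] by (simp add: F_def)
    then show "\<forall>p\<in>SIGMA p:E. F (fst p) \<times> F (snd p).
        (\<lambda>cs. ((?lab (map fst cs), ?lab (map snd cs)), (map fst cs, map snd cs))) ((\<lambda>(_, c, d). zip c d) p) = p"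
      by (auto simp: F_def length_flag)
    show "(\<lambda>cs. ((?lab (map fst cs), ?lab (map snd cs)), (map fst cs, map snd cs))) ` D
        \<subseteq> (SIGMA p:E. F (fst p) \<times> F (snd p))"
      using lab by (auto simp: D_def E_def F_def label_sequence_segre dest: maximal_chains_segre_flags)
    show "(\<lambda>(_, c, d). zip c d) ` (SIGMA p:E. F (fst p) \<times> F (snd p)) \<subseteq> D"
      using len by (auto simp: D_def E_def F_def label_sequence_segre length_flag
        intro!: flags_maximal_chains_segre)
  qed
  then have "card D = card (SIGMA p:E. F (fst p) \<times> F (snd p))"
    by (rule bij_betw_same_card)
  also have "\<dots> = (\<Sum>p\<in>E. card (F (fst p) \<times> F (snd p)))"
  proof (rule card_SigmaI)
    show "finite E" unfolding E_def by (rule finite_subset[of _ "?S \<times> ?S"]) auto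
    show "\<forall>p\<in>E. finite (F (fst p) \<times> F (snd p))"
      using card_F by (auto simp: E_def card_cartesian_product intro!: card_ge_0_finite)
  qed
  also have "\<dots> = (\<Sum>(s, t)\<in>E. CARD('a) ^ (inversions s + inversions t))"
    by (intro sum.cong refl) (auto simp: E_def card_cartesian_product card_F power_add)
  also have "\<dots> = (\<Sum>(s, t)\<in>?S \<times> ?S. of_bool (descending (zip s t)) * CARD('a) ^ (inversions s + inversions t))"
    by (rule sum.mono_neutral_cong_left) (auto simp: E_def)
  also have "\<dots> = (\<Sum>s\<in>?S. \<Sum>t\<in>?S. of_bool (descending (zip s t)) * CARD('a) ^ (inversions s + inversions t))"
    by (rule sum.cartesian_product[symmetric])
  finally show ?thesis
    using False by (simp add: num_descending_chains_def descending_weight_def D_def)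
qed

theorem theorem4p7:
  fixes q n :: nat
  assumes "primepow q"
    and "CARD('a::{field,finite}) = q"
    and "n \<ge> 1"
  shows "(\<Sum>i=0..n. (q_binomial q n i)\<^sup>2 * (-1) ^ i * real (num_descending_chains TYPE('a) i)) = 0"
  using alternating_sum_descending_weight[OF assms(3), of q] assms(2)
  by (simp add: num_descending_chains_eq_weight)

end
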